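(* Let $p\geq 7$ be a prime and let $\zeta_p:\{\xi\in\mathbb{Z}:\gcd(\xi,p)=1\}\to\{0,1\}$ be a function such that (1) if $\gcd(\theta_1,p)=\gcd(\theta_2,p)=1$ and $\theta_1\equiv\theta_2\pmod p$, then $\zeta_p(\theta_1)=\zeta_p(\theta_2)$; (2) the sets $A_i=\{a:\zeta_p(a)=i,\ 1\leq a\leq p-1\}$, $i=0,1$, satisfy $|A_0|=|A_1|=\frac{p-1}{2}$; and (3) $\zeta_p(\theta)=\frac{1+\chi_p(\theta)}{2}$ for a function $\chi_p:\{\xi\in\mathbb{Z}:\gcd(\xi,p)=1\}\to\{-1,1\}$ satisfying $\chi_p(\theta_1\theta_2)=\chi_p(\theta_1)\chi_p(\theta_2)$ for all $\theta_1,\theta_2$ relatively prime to $p$. Let $S=\{1,2,\ldots,2p-1\}$. Then the join graph $\overline{K}_p+KP_{(p-1)/2,0,(p-1)/2}$ is an arithmetic cordial graph modulo $p$ under $\langle S,\zeta_p,\cdot\rangle$, where $\cdot$ is ordinary multiplication of integers.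
   Context: $\overline{K}_n$ is the graph with $n$ vertices and no edges. Kayak paddle graph: $KP_{n,m,k}$ is the graph of order $n+m+k$ created from two disjoint cycles $C_n$ and $C_k$ (on $n$ and $k$ vertices) and a path $P_{m+2}$ on $m+2$ vertices, one pendant (end) vertex of $P_{m+2}$ being a vertex of $C_n$ and the other being a vertex of $C_k$. In particular $KP_{n,0,k}$ is two disjoint cycles $C_n$, $C_k$ plus one edge joining a vertex of $C_n$ to a vertex of $C_k$. Join graph: $G+H$ has vertex set $V(G)\cup V(H)$ (disjoint union) and edge set $E(G)\cup E(H)\cup\{ab:a\in V(G),\ b\in V(H)\}$. Arithmetic cordial graph: let $\eta$ be a positive integer, $S\subseteq\mathbb{Z}$, $\star:S\times S\to\mathbb{Z}$ a binary function, and $\zeta_\eta:\{\xi\in\mathbb{Z}:\gcd(\xi,\eta)=1\}\to\{0,1\}$ a function. The triple $\langle S,\zeta_\eta,\star\rangle$ is called an arithmetic structure. For a simple connected graph $\Gamma$ of order $N$, a bijection $f:V(\Gamma)\to S$ (where $|S|=N$) is an arithmetic cordial labeling modulo $\eta$ under $\langle S,\zeta_\eta,\star\rangle$ if the induced function $f_\eta^*:E(\Gamma)\to\{0,1\}$, defined by $f_\eta^*(ab)=0$ if $\gcd(f(a)\star f(b),\eta)\neq 1$ or $\zeta_\eta(f(a)\star f(b))=0$, and $f_\eta^*(ab)=1$ if $\gcd(f(a)\star f(b),\eta)=1$ and $\zeta_\eta(f(a)\star f(b))=1$, satisfies $|e_{f_\eta^*}(0)-e_{f_\eta^*}(1)|\leq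 1$, where $e_{f_\eta^*}(i)$ is the number of edges with label $i$. A graph admitting such a labeling is an arithmetic cordial graph modulo $\eta$ under $\langle S,\zeta_\eta,\star\rangle$. *)

theory Defs
  imports Complex_Main "HOL-Library.FuncSet" "HOL-Computational_Algebra.Primes"
begin

text \<open>
  An undirected graph is a set of vertices together with a set of edges, an edge \<open>ab\<close> being the
  unordered pair \<open>{a, b}\<close>.
\<close>

record 'a ugraph =
  verts :: "'a set"
  edges :: "'a set set"

definition simple_graph :: "'a ugraph \<Rightarrow> bool" where
  "simple_graph G \<longleftrightarrow>
     finite (verts G) \<and> edges G \<subseteq> {{u, v} |u v. u \<in> verts G \<and> v \<in> verts G \<and> u \<noteq> v}"

definition connected_graph :: "'a ugraph \<Rightarrow> bool" where
  "connected_graph G \<longleftrightarrow> verts G \<noteq> {} \<and>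
     (\<forall>u \<in> verts G. \<forall>v \<in> verts G. (u, v) \<in> {(a, b). {a, b} \<in> edges G}\<^sup>*)"

definition graph_union :: "'a ugraph \<Rightarrow> 'a ugraph \<Rightarrow> 'a ugraph" where
  "graph_union G H = \<lparr>verts = verts G \<union> verts H, edges = edges G \<union> edges H\<rparr>"

definition graph_join :: "'a ugraph \<Rightarrow> 'b ugraph \<Rightarrow> ('a + 'b) ugraph" where
  "graph_join G H =
     \<lparr>verts = verts G <+> verts H,
      edges = (\<lambda>e. Inl ` e) ` edges G \<union> (\<lambda>e. Inr ` e) ` edges H \<union>
              {{Inl a, Inr b} |a b. a \<in> verts G \<and> b \<in> verts H}\<rparr>"

definition empty_graph :: "nat \<Rightarrow> nat ugraph" where
  "empty_graph n = \<lparr>verts = {0..<n}, edges = {}\<rparr>"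

text \<open>
  Cycles and paths on \<open>n\<close> consecutive natural numbers starting at \<open>s\<close>; \<open>cycle_graph s n\<close> is the
  cycle \<open>C\<^sub>n\<close> only for \<open>n \<ge> 3\<close>.
\<close>

definition cycle_graph :: "nat \<Rightarrow> nat \<Rightarrow> nat ugraph" where
  "cycle_graph s n = \<lparr>verts = {s..<s + n}, edges = {{s + i, s + Suc i mod n} |i. i < n}\<rparr>"

definition path_graph :: "nat \<Rightarrow> nat \<Rightarrow> nat ugraph" where
  "path_graph s n = \<lparr>verts = {s..<s + n}, edges = {{s + i, s + Suc i} |i. Suc i < n}\<rparr>"

text \<open>
  The kayak paddle graph on the vertices \<open>0, \<dots>, n + m + k - 1\<close>, for \<open>n, k \<ge> 3\<close>: the path
  on \<open>m + 2\<close> vertices runs from \<open>n - 1\<close>, the last vertex of the first cycle, to \<open>n + m\<close>, the first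
  vertex of the second cycle.
\<close>

definition kayak_paddle :: "nat \<Rightarrow> nat \<Rightarrow> nat \<Rightarrow> nat ugraph" where
  "kayak_paddle n m k =
     graph_union (graph_union (cycle_graph 0 n) (path_graph (n - 1) (m + 2)))
                 (cycle_graph (n + m) k)"

text \<open>
  The partial functions \<open>\<zeta>\<close> and \<open>\<star>\<close> are represented by total ones, whose values outside
  of \<open>{\<xi>. gcd(\<xi>, \<eta>) = 1}\<close> and \<open>S \<times> S\<close>, respectively, are never used; \<open>S \<subseteq> \<int>\<close> and the
  codomain of \<open>\<star>\<close> are expressed by the types.
\<close>

definition arithmetic_structure ::
  "nat \<Rightarrow> int set \<Rightarrow> (int \<Rightarrow> nat) \<Rightarrow> (int \<Rightarrow> int \<Rightarrow> int) \<Rightarrow> bool" where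
  "arithmetic_structure \<eta> S \<zeta> star \<longleftrightarrow> 0 < \<eta> \<and> \<zeta> \<in> {\<xi>. gcd \<xi> (int \<eta>) = 1} \<rightarrow> {0, 1}"

text \<open>
  \<open>g\<close> is the edge function induced by \<open>f\<close>. It is a relation because \<open>\<star>\<close> need not be
  commutative: an induced function on unordered edges exists only if the two orientations of every
  edge give the same label, and it is then unique on the edges.
\<close>

definition induced_edge_labeling ::
  "nat \<Rightarrow> (int \<Rightarrow> nat) \<Rightarrow> (int \<Rightarrow> int \<Rightarrow> int) \<Rightarrow> 'a ugraph \<Rightarrow> ('a \<Rightarrow> int) \<Rightarrow> ('a set \<Rightarrow> nat) \<Rightarrow> bool" where
  "induced_edge_labeling \<eta> \<zeta> star G f g \<longleftrightarrow>
     (\<forall>a b. {a, b} \<in> edges G \<longrightarrow>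
        g {a, b} = (if gcd (star (f a) (f b)) (int \<eta>) = 1 \<and> \<zeta> (star (f a) (f b)) = 1
                    then 1 else 0))"

definition arithmetic_cordial_labeling ::
  "nat \<Rightarrow> int set \<Rightarrow> (int \<Rightarrow> nat) \<Rightarrow> (int \<Rightarrow> int \<Rightarrow> int) \<Rightarrow> 'a ugraph \<Rightarrow> ('a \<Rightarrow> int) \<Rightarrow> bool" where
  "arithmetic_cordial_labeling \<eta> S \<zeta> star G f \<longleftrightarrow>
     bij_betw f (verts G) S \<and>
     (\<exists>g. induced_edge_labeling \<eta> \<zeta> star G f g \<and>
          \<bar>int (card {e \<in> edges G. g e = 0}) - int (card {e \<in> edges G. g e = 1})\<bar> \<le> 1)"

definition arithmetic_cordial_graph ::
  "nat \<Rightarrow> int set \<Rightarrow> (int \<Rightarrow> nat) \<Rightarrow> (int \<Rightarrow> int \<Rightarrow> int) \<Rightarrow> 'a ugraph \<Rightarrow> bool" where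
  "arithmetic_cordial_graph \<eta> S \<zeta> star G \<longleftrightarrow>
     arithmetic_structure \<eta> S \<zeta> star \<and> simple_graph G \<and> connected_graph G \<and>
     (\<exists>f. arithmetic_cordial_labeling \<eta> S \<zeta> star G f)"

end

theory Submission imports Defs begin

text \<open>
  Count every edge as \<open>+1\<close> if its label is 1 and as \<open>-1\<close> if its label is 0; a labeling is cordial iff
  the total is \<open>-1\<close>, 0 or 1.  An edge whose product is prime to \<open>p\<close> counts as \<open>\<chi>\<close> of that product,
  hence as the product of the two signs \<open>\<chi>\<close> at its ends.

  Put the residues \<open>1, \<dots>, p - 1\<close> on the kayak paddle, those with \<open>\<chi> = 1\<close> on one cycle and those
  with \<open>\<chi> = -1\<close> on the other, and put \<open>p, \<dots>, 2p - 1\<close> on the independent set.  Each cycle has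
  \<open>(p - 1) / 2\<close> vertices, which is exactly the size of each of the two classes.  Inside a cycle
  all signs agree, so the \<open>p - 1\<close> cycle edges count \<open>+1\<close> each, and the bridge between the
  cycles counts \<open>-1\<close>.  The vertex labeled \<open>p\<close> only has edges of label 0, which contribute
  \<open>-(p - 1)\<close>.  Every other vertex of the independent set sees the two classes equally often, so its
  edges cancel.  The total is \<open>(p - 1) - 1 - (p - 1) = -1\<close>.

  The hypothesis \<open>p \<ge> 7\<close> makes \<open>(p - 1) / 2 \<ge> 3\<close>, so that the two cycles are genuine cycles.
  The proof rests on three additivity statements: \<open>card_labels_diff\<close> turns the balance condition
  into a sum over the edges, and \<open>sum_edges_graph_join\<close> and \<open>sum_edges_kayak_paddle\<close> split such a
  sum along the two graph constructions.
\<close>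

section \<open>Joins\<close>

lemma simple_graph_edge_subset:
  assumes "simple_graph G" "e \<in> edges G"
  shows "e \<subseteq> verts G"
  using assms by (auto simp: simple_graph_def)

lemma simple_graph_finite_edges:
  assumes "simple_graph G"
  shows "finite (edges G)"
proof (rule finite_subset)
  show "edges G \<subseteq> Pow (verts G)" "finite (Pow (verts G))"
    using assms unfolding simple_graph_def by auto
qed

lemma simple_graph_graph_join:
  assumes "simple_graph G" "simple_graph H"
  shows "simple_graph (graph_join G H)"
  unfolding simple_graph_def
proof (intro conjI subsetI)
  show "finite (verts (graph_join G H))"
    using assms by (auto simp: simple_graph_def graph_join_def)
  fix e assume "e \<in> edges (graph_join G H)"
  then consider d where "d \<in> edges G" "e = Inl ` d" | d where "d \<in> edges H" "e = Inr ` d"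
    | a b where "a \<in> verts G" "b \<in> verts H" "e = {Inl a, Inr b}"
    by (auto simp: graph_join_def)
  then show "e \<in> {{u, v} |u v. u \<in> verts (graph_join G H) \<and> v \<in> verts (graph_join G H) \<and> u \<noteq> v}"
  proof cases
    case 1
    then obtain u v where "d = {u, v}" "u \<in> verts G" "v \<in> verts G" "u \<noteq> v"
      using assms(1) unfolding simple_graph_def by blast
    with 1 have "e = {Inl u, Inl v}" "Inl u \<in> verts (graph_join G H)"
      "Inl v \<in> verts (graph_join G H)" "(Inl u :: 'a + 'b) \<noteq> Inl v"
      by (auto simp: graph_join_def)
    then show ?thesis by blast
  next
    case 2
    then obtain u v where "d = {u, v}" "u \<in> verts H" "v \<in> verts H" "u \<noteq> v"
      using assms(2) unfolding simple_graph_def by blast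
    with 2 have "e = {Inr u, Inr v}" "Inr u \<in> verts (graph_join G H)"
      "Inr v \<in> verts (graph_join G H)" "(Inr u :: 'a + 'b) \<noteq> Inr v"
      by (auto simp: graph_join_def)
    then show ?thesis by blast
  next
    case 3
    then have "Inl a \<in> verts (graph_join G H)" "Inr b \<in> verts (graph_join G H)"
      "(Inl a :: 'a + 'b) \<noteq> Inr b"
      by (auto simp: graph_join_def)
    with 3 show ?thesis by blast
  qed
qed

text \<open>
  Two vertices on opposite sides are adjacent; two vertices on the same side have a common neighbour
  on the other side, which is nonempty.
\<close>

lemma connected_graph_graph_join:
  assumes "verts G \<noteq> {}" "verts H \<noteq> {}"
  shows "connected_graph (graph_join G H)"
proof -
  define R where "R = {(a, b). {a, b} \<in> edges (graph_join G H)}"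
  have R: "(Inl a, Inr b) \<in> R" "(Inr b, Inl a) \<in> R" if "a \<in> verts G" "b \<in> verts H" for a b
    using that by (auto simp: R_def graph_join_def insert_commute)
  obtain a0 b0 where ab0: "a0 \<in> verts G" "b0 \<in> verts H" using assms by auto
  have "(u, v) \<in> R\<^sup>*" if uv: "u \<in> verts (graph_join G H)" "v \<in> verts (graph_join G H)" for u v
  proof -
    have dir: "(Inl a, Inr b) \<in> R\<^sup>*" "(Inr b, Inl a) \<in> R\<^sup>*"
      if "a \<in> verts G" "b \<in> verts H" for a b
      using R[OF that] by auto
    have "(Inl a, Inl a') \<in> R\<^sup>*" if "a \<in> verts G" "a' \<in> verts G" for a a'
      using dir(1)[OF that(1) ab0(2)] dir(2)[OF that(2) ab0(2)] by (rule rtrancl_trans)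
    moreover have "(Inr b, Inr b') \<in> R\<^sup>*" if "b \<in> verts H" "b' \<in> verts H" for b b'
      using dir(2)[OF ab0(1) that(1)] dir(1)[OF ab0(1) that(2)] by (rule rtrancl_trans)
    ultimately show ?thesis using uv dir by (auto simp: graph_join_def)
  qed
  with ab0 show ?thesis unfolding connected_graph_def R_def[symmetric]
    by (auto simp: graph_join_def)
qed

lemma sum_edges_graph_join:
  fixes w :: "('a + 'b) set \<Rightarrow> 'c::comm_monoid_add"
  assumes "simple_graph G" "simple_graph H"
  shows "(\<Sum>e\<in>edges (graph_join G H). w e) =
    (\<Sum>e\<in>edges G. w (Inl ` e)) + (\<Sum>e\<in>edges H. w (Inr ` e)) +
    (\<Sum>a\<in>verts G. \<Sum>b\<in>verts H. w {Inl a, Inr b})"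
proof -
  have fin: "finite (verts G)" "finite (verts H)" "finite (edges G)" "finite (edges H)"
    using assms simple_graph_finite_edges by (auto simp: simple_graph_def)
  let ?GG = "(`) Inl ` edges G :: ('a + 'b) set set"
  let ?HH = "(`) Inr ` edges H :: ('a + 'b) set set"
  let ?k = "\<lambda>(a, b). {Inl a, Inr b} :: ('a + 'b) set"
  have inj: "inj_on ((`) (Inl :: 'a \<Rightarrow> 'a + 'b)) (edges G)"
    "inj_on ((`) (Inr :: 'b \<Rightarrow> 'a + 'b)) (edges H)"
    "inj_on ?k (verts G \<times> verts H)"
    by (auto simp: inj_on_def doubleton_eq_iff inj_image_eq_iff)
  \<comment> \<open>An edge of one side is nonempty, so it cannot also be an edge of the other side.\<close>
  have "{} \<notin> edges G" using assms(1) by (auto simp: simple_graph_def)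
  then have disj: "?GG \<inter> ?HH = {}" "(?GG \<union> ?HH) \<inter> ?k ` (verts G \<times> verts H) = {}"
    by (auto simp: set_eq_iff image_iff)
       (metis Inr_Inl_False all_not_in_conv)+
  have "edges (graph_join G H) = (?GG \<union> ?HH) \<union> ?k ` (verts G \<times> verts H)"
    by (auto simp: graph_join_def)
  then have "(\<Sum>e\<in>edges (graph_join G H). w e) =
      sum w ?GG + sum w ?HH + sum w (?k ` (verts G \<times> verts H))"
    using fin disj by (simp add: sum.union_disjoint)
  also have "sum w (?k ` (verts G \<times> verts H)) = (\<Sum>a\<in>verts G. \<Sum>b\<in>verts H. w {Inl a, Inr b})"
    unfolding sum.reindex[OF inj(3)] sum.cartesian_product by (simp add: case_prod_unfold)
  finally show ?thesis
    by (simp add: sum.reindex[OF inj(1)] sum.reindex[OF inj(2)])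
qed

section \<open>Cycles and kayak paddles\<close>

lemma edges_cycle_graph: "edges (cycle_graph s n) = (\<lambda>i. {s + i, s + Suc i mod n}) ` {..<n}"
  by (auto simp: cycle_graph_def)

lemma simple_graph_cycle_graph:
  assumes "n \<ge> 2"
  shows "simple_graph (cycle_graph s n)"
proof -
  have "{s + i, s + Suc i mod n} \<in> {{u, v} |u v. u \<in> {s..<s + n} \<and> v \<in> {s..<s + n} \<and> u \<noteq> v}"
    if "i < n" for i
  proof -
    have "s + i \<in> {s..<s + n}" "s + Suc i mod n \<in> {s..<s + n}" "s + i \<noteq> s + Suc i mod n"
      using assms that by (auto simp: mod_Suc)
    then show ?thesis by blast
  qed
  then show ?thesis unfolding simple_graph_def edges_cycle_graph
    by (simp add: cycle_graph_def image_subset_iff)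
qed

text \<open>
  Two distinct indices give the same edge only if each is the successor of the other modulo \<open>n\<close>, which
  requires \<open>n \<le> 2\<close>.
\<close>

lemma card_edges_cycle_graph:
  assumes "n \<ge> 3"
  shows "card (edges (cycle_graph s n)) = n"
proof -
  have "inj_on (\<lambda>i. {s + i, s + Suc i mod n}) {..<n}"
    using assms by (auto simp: inj_on_def doubleton_eq_iff mod_Suc split: if_splits)
  then show ?thesis unfolding edges_cycle_graph by (simp add: card_image)
qed

lemma edges_kayak_paddle_no_path:
  assumes "n \<ge> 1"
  shows "edges (kayak_paddle n 0 k) =
    edges (cycle_graph 0 n) \<union> edges (cycle_graph n k) \<union> {{n - 1, n}}"
  using assms by (auto simp: kayak_paddle_def graph_union_def path_graph_def)

lemma verts_kayak_paddle_no_path: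
  assumes "n \<ge> 1" "k \<ge> 1"
  shows "verts (kayak_paddle n 0 k) = {0..<n + k}"
  using assms by (auto simp: kayak_paddle_def graph_union_def path_graph_def cycle_graph_def)

lemma edge_cycle_graph_subset:
  assumes "simple_graph (cycle_graph s n)" "e \<in> edges (cycle_graph s n)"
  shows "e \<subseteq> {s..<s + n}" "e \<noteq> {}"
  using assms by (auto simp: simple_graph_def cycle_graph_def)

lemma simple_graph_kayak_paddle_no_path:
  assumes "n \<ge> 2" "k \<ge> 2"
  shows "simple_graph (kayak_paddle n 0 k)"
proof -
  have n: "n \<ge> 1" using assms by simp
  let ?D = "\<lambda>V::nat set. {{u, v} |u v. u \<in> V \<and> v \<in> V \<and> u \<noteq> v}"
  have mono: "?D U \<subseteq> ?D V" if "U \<subseteq> V" for U V using that by blast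
  have sub: "edges (cycle_graph 0 n) \<subseteq> ?D {0..<n}" "edges (cycle_graph n k) \<subseteq> ?D {n..<n + k}"
    using simple_graph_cycle_graph[OF assms(1), of 0] simple_graph_cycle_graph[OF assms(2), of n]
    by (auto simp: simple_graph_def cycle_graph_def)
  have "edges (cycle_graph 0 n) \<subseteq> ?D {0..<n + k}"
    by (rule subset_trans[OF sub(1) mono]) simp
  moreover have "edges (cycle_graph n k) \<subseteq> ?D {0..<n + k}"
    by (rule subset_trans[OF sub(2) mono]) simp
  moreover have "{n - 1, n} \<in> ?D {0..<n + k}"
  proof -
    have "n - 1 \<in> {0..<n + k}" "n \<in> {0..<n + k}" "n - 1 \<noteq> n" using assms by auto
    then show ?thesis by blast
  qed
  ultimately have "edges (kayak_paddle n 0 k) \<subseteq> ?D {0..<n + k}"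
    unfolding edges_kayak_paddle_no_path[OF n]
    by (intro Un_least insert_subsetI empty_subsetI)
  then show ?thesis
    using assms by (simp add: simple_graph_def verts_kayak_paddle_no_path)
qed

lemma sum_edges_kayak_paddle:
  fixes w :: "nat set \<Rightarrow> 'c::comm_monoid_add"
  assumes "n \<ge> 2" "k \<ge> 2"
  shows "(\<Sum>e\<in>edges (kayak_paddle n 0 k). w e) =
    (\<Sum>e\<in>edges (cycle_graph 0 n). w e) + (\<Sum>e\<in>edges (cycle_graph n k). w e) + w {n - 1, n}"
proof -
  note sub = edge_cycle_graph_subset[OF simple_graph_cycle_graph[OF assms(1), of 0]]
    edge_cycle_graph_subset[OF simple_graph_cycle_graph[OF assms(2), of n]]
  have disj: "edges (cycle_graph 0 n) \<inter> edges (cycle_graph n k) = {}"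
  proof (rule equals0I)
    fix e assume "e \<in> edges (cycle_graph 0 n) \<inter> edges (cycle_graph n k)"
    then have "e \<subseteq> {0..<0 + n}" "e \<subseteq> {n..<n + k}" "e \<noteq> {}" using sub(1,3,4) by blast+
    then show False by fastforce
  qed
  have bridge: "{n - 1, n} \<notin> edges (cycle_graph 0 n)" "{n - 1, n} \<notin> edges (cycle_graph n k)"
  proof -
    have "\<not> {n - 1, n} \<subseteq> {0..<0 + n}" "\<not> {n - 1, n} \<subseteq> {n..<n + k}" using assms by simp_all
    then show "{n - 1, n} \<notin> edges (cycle_graph 0 n)" "{n - 1, n} \<notin> edges (cycle_graph n k)"
      using sub(1,3) by blast+
  qed
  have fin: "finite (edges (cycle_graph 0 n))" "finite (edges (cycle_graph n k))"
    by (simp_all add: edges_cycle_graph)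
  have "edges (kayak_paddle n 0 k) =
      edges (cycle_graph 0 n) \<union> edges (cycle_graph n k) \<union> {{n - 1, n}}"
    using assms by (intro edges_kayak_paddle_no_path) simp
  then show ?thesis
    using disj bridge fin by (simp add: sum.union_disjoint add.commute)
qed

section \<open>Signed counts of edge labels\<close>

text \<open>
  On an unordered edge the label is well defined as soon as the operation is commutative.
\<close>

lemma induced_edge_labeling_exists:
  assumes "\<And>x y. star x y = star y x"
  shows "\<exists>g. induced_edge_labeling \<eta> \<zeta> star G f g"
proof -
  define L where "L a b \<longleftrightarrow> gcd (star (f a) (f b)) (int \<eta>) = 1 \<and> \<zeta> (star (f a) (f b)) = 1" for a b
  define g :: "'a set \<Rightarrow> nat" where "g e = (if \<exists>a b. e = {a, b} \<and> L a b then 1 else 0)" for e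
  have "L a b = L b a" for a b unfolding L_def by (simp add: assms)
  then have "g {a, b} = (if L a b then 1 else 0)" for a b
    unfolding g_def by (auto simp: doubleton_eq_iff)
  then have "induced_edge_labeling \<eta> \<zeta> star G f g"
    unfolding induced_edge_labeling_def L_def by simp
  then show ?thesis by blast
qed

lemma card_labels_diff:
  fixes g :: "'e \<Rightarrow> nat"
  assumes "finite E" "\<And>e. e \<in> E \<Longrightarrow> g e \<in> {0, 1}"
  shows "int (card {e \<in> E. g e = 1}) - int (card {e \<in> E. g e = 0}) = (\<Sum>e\<in>E. 2 * int (g e) - 1)"
proof -
  have "int (card {e \<in> E. g e = 1}) - int (card {e \<in> E. g e = 0})
      = (\<Sum>e\<in>E. if g e = 1 then 1 else 0) - (\<Sum>e\<in>E. if g e = 0 then 1 else 0)"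
    using assms(1) by (simp add: sum.If_cases Int_def)
  also have "\<dots> = (\<Sum>e\<in>E. (if g e = 1 then 1 else 0) - (if g e = 0 then 1 else 0))"
    by (simp add: sum_subtractf)
  also have "\<dots> = (\<Sum>e\<in>E. 2 * int (g e) - 1)"
    using assms(2) by (intro sum.cong) auto
  finally show ?thesis .
qed

section \<open>The labeling\<close>

theorem theorem5p1:
  fixes p :: nat and \<zeta> :: "int \<Rightarrow> nat" and \<chi> :: "int \<Rightarrow> int"
  assumes "prime p" and "p \<ge> 7"
    and zeta_range: "\<zeta> \<in> {\<xi>. gcd \<xi> (int p) = 1} \<rightarrow> {0, 1}"
    and zeta_cong: "\<And>\<theta>\<^sub>1 \<theta>\<^sub>2. gcd \<theta>\<^sub>1 (int p) = 1 \<Longrightarrow> gcd \<theta>\<^sub>2 (int p) = 1 \<Longrightarrow>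
           \<theta>\<^sub>1 mod int p = \<theta>\<^sub>2 mod int p \<Longrightarrow> \<zeta> \<theta>\<^sub>1 = \<zeta> \<theta>\<^sub>2"
    and card_A0: "card {a :: int. \<zeta> a = 0 \<and> 1 \<le> a \<and> a \<le> int p - 1} = (p - 1) div 2"
    and card_A1: "card {a :: int. \<zeta> a = 1 \<and> 1 \<le> a \<and> a \<le> int p - 1} = (p - 1) div 2"
    and chi_range: "\<chi> \<in> {\<xi>. gcd \<xi> (int p) = 1} \<rightarrow> {-1, 1}"
    and chi_mult: "\<And>\<theta>\<^sub>1 \<theta>\<^sub>2. gcd \<theta>\<^sub>1 (int p) = 1 \<Longrightarrow> gcd \<theta>\<^sub>2 (int p) = 1 \<Longrightarrow>
           \<chi> (\<theta>\<^sub>1 * \<theta>\<^sub>2) = \<chi> \<theta>\<^sub>1 * \<chi> \<theta>\<^sub>2"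
    and zeta_chi: "\<And>\<theta>. gcd \<theta> (int p) = 1 \<Longrightarrow> real (\<zeta> \<theta>) = (1 + real_of_int (\<chi> \<theta>)) / 2"
  shows "arithmetic_cordial_graph p {1..2 * int p - 1} \<zeta> (*)
           (graph_join (empty_graph p) (kayak_paddle ((p - 1) div 2) 0 ((p - 1) div 2)))"
proof -
  define n where "n = (p - 1) div 2"
  have "odd p" using assms(1,2) prime_odd_nat by force
  then have p: "p = 2 * n + 1" unfolding n_def by auto
  with \<open>p \<ge> 7\<close> have n: "n \<ge> 3" by simp
  define K where "K = kayak_paddle n 0 n"
  define G where "G = graph_join (empty_graph p) K"
  have vK: "verts K = {0..<n + n}"
    unfolding K_def using n by (intro verts_kayak_paddle_no_path) auto
  have simpK: "simple_graph K"
    unfolding K_def using n by (intro simple_graph_kayak_paddle_no_path) auto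
  have simpE: "simple_graph (empty_graph p)" and vE: "verts (empty_graph p) = {0..<p}"
    by (auto simp: simple_graph_def empty_graph_def)
  have simpG: "simple_graph G"
    unfolding G_def by (rule simple_graph_graph_join[OF simpE simpK])

  have cop: "gcd a (int p) = 1 \<longleftrightarrow> \<not> int p dvd a" for a
  proof -
    have "prime (int p)" using \<open>prime p\<close> by simp
    then have "coprime (int p) a \<longleftrightarrow> \<not> int p dvd a"
      using prime_imp_coprime[of "int p" a] coprime_absorb_left[of "int p" a] by auto
    then show ?thesis by (simp add: coprime_iff_gcd_eq_1 gcd.commute)
  qed
  have chi_cases: "\<chi> a = 1 \<or> \<chi> a = -1" if "\<not> int p dvd a" for a
    using PiE[OF chi_range, of a] that by (auto simp: cop)
  have zeta_iff: "\<zeta> a = 1 \<longleftrightarrow> \<chi> a = 1" "\<zeta> a = 0 \<longleftrightarrow> \<chi> a = -1" if "\<not> int p dvd a" for a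
    using zeta_chi[of a] chi_cases[OF that] that unfolding cop by auto

  \<comment> \<open>\<open>?A 1\<close> and \<open>?A 0\<close> are the residues of sign 1 and -1; \<open>h\<close> puts them on the first and on the
    second cycle of the paddle.\<close>
  let ?A = "\<lambda>c::nat. {a :: int. \<zeta> a = c \<and> 1 \<le> a \<and> a \<le> int p - 1}"
  have resid: "\<not> int p dvd a" if "1 \<le> a" "a \<le> int p - 1" for a
    using that zdvd_not_zless[of a "int p"] by simp
  have finA: "finite (?A c)" for c by (rule finite_subset[of _ "{1..int p - 1}"]) auto
  obtain h1 where h1: "bij_betw h1 {0..<n} (?A 1)"
    using finA[of 1] card_A1 ex_bij_betw_nat_finite[of "?A 1"] by (auto simp: n_def)
  obtain h0 where h0: "bij_betw h0 {n..<n + n} (?A 0)"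
    using finA[of 0] card_A0 finite_same_card_bij[of "{n..<n + n}" "?A 0"] by (auto simp: n_def)
  define h where "h j = (if j < n then h1 j else h0 j)" for j
  have h_lo: "h j \<in> ?A 1" if "j < n" for j
    using bij_betwE[OF h1] that by (auto simp: h_def)
  have h_hi: "h j \<in> ?A 0" if "n \<le> j" "j < n + n" for j
    using bij_betwE[OF h0] that by (auto simp: h_def)
  have h_res: "1 \<le> h j" "h j \<le> int p - 1" if "j < n + n" for j
    using h_lo[of j] h_hi[of j] that by (cases "j < n"; auto)+
  have chi_h: "\<chi> (h j) = (if j < n then 1 else -1)" if "j < n + n" for j
    using h_lo[of j] h_hi[of j] that zeta_iff[OF resid[OF h_res[OF that]]] by auto
  have bij_h: "bij_betw h {0..<n + n} {1..int p - 1}"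
  proof -
    have "bij_betw h {0..<n} (?A 1)" "bij_betw h {n..<n + n} (?A 0)"
      using h1 h0 bij_betw_cong[of "{0..<n}" h h1] bij_betw_cong[of "{n..<n + n}" h h0]
      by (simp_all add: h_def)
    then have "bij_betw h ({0..<n} \<union> {n..<n + n}) (?A 1 \<union> ?A 0)"
      by (rule bij_betw_combine) auto
    moreover have "{0..<n} \<union> {n..<n + n} = {0..<n + n}" by auto
    moreover have "?A 1 \<union> ?A 0 = {1..int p - 1}"
    proof -
      have "\<zeta> a = 1 \<or> \<zeta> a = 0" if "1 \<le> a" "a \<le> int p - 1" for a
        using zeta_iff[OF resid[OF that]] chi_cases[OF resid[OF that]] by argo
      then show ?thesis
        by (intro set_eqI) (simp only: Un_iff mem_Collect_eq atLeastAtMost_iff, blast)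
    qed
    ultimately show ?thesis by simp
  qed

  define f where "f = case_sum (\<lambda>i. int p + int i) h"
  have bij_f: "bij_betw f (verts G) {1..2 * int p - 1}"
  proof -
    have "bij_betw (\<lambda>i. int p + int i) {0..<p} {int p..2 * int p - 1}"
      by (rule bij_betw_byWitness[where f' = "\<lambda>x. nat (x - int p)"]) auto
    then have "bij_betw (f \<circ> Inl) {0..<p} {int p..2 * int p - 1}"
      by (simp add: f_def comp_def)
    then have 1: "bij_betw f (Inl ` {0..<p}) {int p..2 * int p - 1}"
      by (subst bij_betw_comp_iff[where f = Inl and A = "{0..<p}"]) (simp_all add: bij_betw_def)
    have "bij_betw (f \<circ> Inr) {0..<n + n} {1..int p - 1}"
      using bij_h by (simp add: f_def comp_def)
    then have 2: "bij_betw f (Inr ` {0..<n + n}) {1..int p - 1}"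
      by (subst bij_betw_comp_iff[where f = Inr and A = "{0..<n + n}"]) (simp_all add: bij_betw_def)
    have "bij_betw f (Inl ` {0..<p} \<union> Inr ` {0..<n + n}) ({int p..2 * int p - 1} \<union> {1..int p - 1})"
      using 1 2 by (rule bij_betw_combine) auto
    moreover have "{int p..2 * int p - 1} \<union> {1..int p - 1} = {1..2 * int p - 1}"
      using p by auto
    moreover have "verts G = Inl ` {0..<p} \<union> Inr ` {0..<n + n}"
      by (simp add: G_def graph_join_def vE vK Plus_def)
    ultimately show ?thesis by simp
  qed

  obtain g where g: "induced_edge_labeling p \<zeta> (*) G f g"
    using induced_edge_labeling_exists[of "(*)" p \<zeta> G f] by (auto simp: mult.commute)
  define w where "w e = 2 * int (g e) - 1" for e
  have w: "w {a, b} = (if int p dvd f a * f b then -1 else \<chi> (f a * f b))"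
    if "{a, b} \<in> edges G" for a b
  proof -
    have "g {a, b} = (if \<not> int p dvd f a * f b \<and> \<zeta> (f a * f b) = 1 then 1 else 0)"
      using g that unfolding induced_edge_labeling_def cop by blast
    then show ?thesis
      using zeta_iff(1)[of "f a * f b"] chi_cases[of "f a * f b"] by (auto simp: w_def)
  qed
  have w_coprime: "w {a, b} = \<chi> (f a) * \<chi> (f b)"
    if "{a, b} \<in> edges G" "\<not> int p dvd f a" "\<not> int p dvd f b" for a b
  proof -
    have "\<not> int p dvd f a * f b"
      using that(2,3) \<open>prime p\<close> by (simp add: prime_dvd_mult_iff)
    then show ?thesis using w[OF that(1)] chi_mult[of "f a" "f b"] that(2,3) unfolding cop by simp
  qed

  have w_paddle: "w (Inr ` {i, j}) = \<chi> (h i) * \<chi> (h j)" if "{i, j} \<in> edges K" for i j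
  proof -
    have "i < n + n" "j < n + n" using simple_graph_edge_subset[OF simpK that] vK by auto
    moreover have "{Inr i, Inr j} \<in> edges G"
      using that by (auto simp: G_def graph_join_def intro!: image_eqI[of _ _ "{i, j}"])
    ultimately show ?thesis
      using w_coprime[of "Inr i" "Inr j"] resid[OF h_res] by (simp add: f_def)
  qed
  have edgesK: "edges K = edges (cycle_graph 0 n) \<union> edges (cycle_graph n n) \<union> {{n - 1, n}}"
    unfolding K_def using n by (intro edges_kayak_paddle_no_path) simp
  have cyc: "w (Inr ` e) = 1" if e: "e \<in> edges (cycle_graph s n)" and s: "s = 0 \<or> s = n" for e s
  proof -
    obtain i j where ij: "e = {i, j}" "i \<in> {s..<s + n}" "j \<in> {s..<s + n}"
      using e simple_graph_cycle_graph[of n s] n by (auto simp: simple_graph_def cycle_graph_def)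
    then have "{i, j} \<in> edges K" using e s edgesK by auto
    then show ?thesis using w_paddle[of i j] ij s chi_h[of i] chi_h[of j] by auto
  qed
  have bridge: "w (Inr ` {n - 1, n}) = -1"
    using w_paddle[of "n - 1" n] edgesK chi_h[of "n - 1"] chi_h[of n] n by simp
  have sumK: "(\<Sum>e\<in>edges K. w (Inr ` e)) = 2 * int n - 1"
    unfolding K_def using n cyc bridge
    by (subst sum_edges_kayak_paddle) (simp_all add: card_edges_cycle_graph)

  have in_G: "{Inl a, Inr b} \<in> edges G" if "a < p" "b < n + n" for a b
    using that by (auto simp: G_def graph_join_def vE vK)
  have sum_h: "(\<Sum>b\<in>{0..<n + n}. \<chi> (h b)) = 0"
  proof -
    have "(\<Sum>b\<in>{0..<n + n}. \<chi> (h b)) = (\<Sum>b\<in>{0..<n + n}. if b < n then 1 else -1)"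
      by (intro sum.cong) (auto simp: chi_h)
    also have "\<dots> = (\<Sum>b\<in>{0..<n}. if b < n then 1 else -1) + (\<Sum>b\<in>{n..<n + n}. if b < n then 1 else -1)"
      by (rule sum.atLeastLessThan_concat[symmetric]) auto
    also have "\<dots> = 0" by simp
    finally show ?thesis .
  qed
  \<comment> \<open>The vertex \<open>Inl 0\<close> has label \<open>p\<close>, the only multiple of \<open>p\<close> among the labels.\<close>
  have row0: "(\<Sum>b\<in>{0..<n + n}. w {Inl 0, Inr b}) = - 2 * int n"
  proof -
    have "w {Inl 0, Inr b} = -1" if "b < n + n" for b
      using w[OF in_G[OF _ that, of 0]] p by (simp add: f_def)
    then show ?thesis by simp
  qed
  have row: "(\<Sum>b\<in>{0..<n + n}. w {Inl a, Inr b}) = 0" if a: "a \<in> {0..<p} - {0}" for a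
  proof -
    have "\<not> int p dvd int a" using a zdvd_not_zless[of "int a" "int p"] by simp
    then have "\<not> int p dvd f (Inl a)" by (simp add: f_def)
    then have "w {Inl a, Inr b} = \<chi> (f (Inl a)) * \<chi> (h b)" if "b < n + n" for b
      using w_coprime[OF in_G[OF _ that, of a]] a resid[OF h_res[OF that]] by (simp add: f_def)
    then have "(\<Sum>b\<in>{0..<n + n}. w {Inl a, Inr b}) = \<chi> (f (Inl a)) * (\<Sum>b\<in>{0..<n + n}. \<chi> (h b))"
      by (simp add: sum_distrib_left)
    then show ?thesis by (simp add: sum_h)
  qed
  have sumJ: "(\<Sum>a\<in>{0..<p}. \<Sum>b\<in>{0..<n + n}. w {Inl a, Inr b}) = - 2 * int n"
    using p row row0 by (subst sum.remove[of _ 0]) simp_all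

  have total: "(\<Sum>e\<in>edges G. w e) = -1"
    unfolding G_def sum_edges_graph_join[OF simpE simpK] vE vK sumK sumJ
    by (simp add: empty_graph_def)
  have "g e \<in> {0, 1}" if e: "e \<in> edges G" for e
  proof -
    obtain a b where "e = {a, b}" using e simpG unfolding simple_graph_def by blast
    then show ?thesis using g e by (auto simp: induced_edge_labeling_def)
  qed
  then have "int (card {e \<in> edges G. g e = 1}) - int (card {e \<in> edges G. g e = 0}) = -1"
    using card_labels_diff[of "edges G" g] simple_graph_finite_edges[OF simpG] total
    by (simp add: w_def)
  then have "arithmetic_cordial_labeling p {1..2 * int p - 1} \<zeta> (*) G f"
    unfolding arithmetic_cordial_labeling_def using bij_f g by auto
  moreover have "connected_graph G"
    unfolding G_def by (rule connected_graph_graph_join) (use vE vK p n in auto)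
  moreover have "arithmetic_structure p {1..2 * int p - 1} \<zeta> (*)"
    using zeta_range p by (simp add: arithmetic_structure_def)
  ultimately show ?thesis
    using simpG unfolding arithmetic_cordial_graph_def G_def K_def n_def by blast
qed

end
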